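(* Let $T$ be a non-empty finite set of positive integers and let $c=\max T$. Then there exists $K$ such that for every integer $k \ge K$, the $S$-LID sequence $(a_n)_{n\ge1}$ for $S = [k]\setminus (k-T)$ satisfies \[ a_{n+1} \ =\ a_n + a_{n-k} \] for all integers $n > k+c$.
   Context: $[k]=\{1,2,\dots,k\}$ and $k-T=\{k-t : t\in T\}$. For a set $S$ of positive integers, the $S$-legal index difference ($S$-LID) sequence $(a_n)_{n\ge 1}$ is defined recursively: for each positive integer $n$, $a_n$ is the smallest positive integer that cannot be written as $\sum_{\ell\in L} a_\ell$ for some set $L \subseteq \{1,\dots,n-1\}$ such that $|i-j|\notin S$ for all $i,j\in L$ (the empty sum is $0$). *)

theory Defs
  imports Main
begin

definition legal :: "nat set \<Rightarrow> nat set \<Rightarrow> bool" where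
  "legal S L \<longleftrightarrow> (\<forall>i\<in>L. \<forall>j\<in>L. nat \<bar>int i - int j\<bar> \<notin> S)"

text \<open>
  The sequence is indexed from 1; the value at index 0 is a dummy and never enters the recursion.
\<close>

context
  notes conj_cong [fundef_cong]
begin

function lid :: "nat set \<Rightarrow> nat \<Rightarrow> nat" where
  "lid S n = (LEAST m. 0 < m \<and>
     \<not> (\<exists>L. L \<subseteq> {1..<n} \<and> legal S L \<and> m = (\<Sum>l\<in>L. lid S l)))"
  by pat_completeness auto
termination
  by (relation "measure snd") auto

end

declare lid.simps [simp del]

end

theory Submission
  imports Defs
begin

text \<open>
  Write \<open>d = k - c\<close>, and let \<open>M n\<close> be the largest sum over a legal subset of \<open>{1..n}\<close>. Elements of
  a legal set are at least \<open>d\<close> apart, so \<open>M n \<le> a n + M (n - d)\<close>, while always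
  \<open>a (n + 1) \<ge> a n + a (n - k)\<close>. The number \<open>a n + a (n - k)\<close> is never the sum of a legal set
  containing \<open>n\<close>, so equality holds once \<open>M (n - 1) < a n + a (n - k)\<close>. This inequality follows
  as soon as \<open>C * a j \<le> a (j + d)\<close> for a suitable constant \<open>C\<close> depending on \<open>c\<close>. For
  \<open>j \<le> k + c + 1\<close> that ratio bound is a direct estimate when \<open>k\<close> is large, and the recurrence,
  being linear, propagates it to larger \<open>j\<close>.
\<close>

section \<open>Growth of a sequence with bounded increments\<close>

text \<open>Here \<open>d + c\<close> plays the role of \<open>k\<close>. The product in
  \<open>d_large\<close> makes room for the quantity \<open>4 * C * q\<close> arising in
  \<open>ratio_init\<close>.\<close>

locale gap_growth =
  fixes a M :: "nat \<Rightarrow> nat" and c d :: nat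
  assumes c_pos: "0 < c"
    and d_large: "16 * (6 * c + 4) * (25 * c + 16) \<le> d"
    and a_0: "a 0 = 0"
    and a_less: "a n < a (Suc n)"
    and M_0: "M 0 = 0"
    and M_le: "M n \<le> a n + M (n - d)"
    and a_Suc_le_M: "a (Suc n) \<le> M n + 1"
    and a_Suc_ge: "d + c < n \<Longrightarrow> a n + a (n - (d + c)) \<le> a (Suc n)"
    and a_Suc_eq: "d + c < n \<Longrightarrow> M (n - 1) < a n + a (n - (d + c)) \<Longrightarrow>
      a (Suc n) = a n + a (n - (d + c))"
begin

section \<open>Initial values\<close>

lemma a_mono: "i \<le> j \<Longrightarrow> a i \<le> a j"
  by (rule lift_Suc_mono_le[of a]) (simp_all add: a_less less_imp_le)

lemma a_ge: "n \<le> a n"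
proof (induction n)
  case (Suc n)
  then show ?case using a_less[of n] by linarith
qed simp

lemma M_le_a: "n \<le> d \<Longrightarrow> M n \<le> a n"
  using M_le[of n] by (simp add: M_0)

text \<open>Up to index \<open>d\<close> the term \<open>M (n - d)\<close> vanishes, so each
  increment is exactly 1.\<close>

lemma a_eq: "n \<le> d + 1 \<Longrightarrow> a n = n"
proof (induction n)
  case 0
  show ?case by (rule a_0)
next
  case (Suc n)
  then have "a (Suc n) \<le> Suc n"
    using a_Suc_le_M[of n] M_le_a[of n] by simp
  then show ?case using a_ge[of "Suc n"] by simp
qed

lemma a_Suc_le: "a (Suc n) \<le> a n + 1 + M (n - d)"
  using a_Suc_le_M[of n] M_le[of n] by simp

lemma d_bounds: "4 * c \<le> d" "2 * c * (2 * c + 1) \<le> d"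
  "4 * (6 * c + 4) * (25 * c + 16) \<le> d"
  using d_large by (simp_all add: algebra_simps)

text \<open>The argument \<open>n - d\<close> still lies where \<open>a\<close> is the identity, so
  the step from \<open>s\<close> to \<open>s + 1\<close> adds at most
  \<open>s + 2 \<le> 2 * c + 1\<close>.\<close>

lemma a_le_after_linear: "s \<le> 2 * c \<Longrightarrow> a (d + 1 + s) \<le> d + 1 + s * (2 * c + 1)"
proof (induction s)
  case 0
  then show ?case by (simp add: a_eq)
next
  case (Suc s)
  have "M (d + 1 + s - d) \<le> a (1 + s)"
    using M_le_a[of "1 + s"] Suc.prems d_bounds(1) by simp
  also have "\<dots> = 1 + s"
    using Suc.prems d_bounds(1) by (intro a_eq) simp
  finally show ?case
    using a_Suc_le[of "d + 1 + s"] Suc by simp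
qed

text \<open>The range ends at \<open>k + c + 1\<close>, the last index that the recurrence does not
  determine.\<close>

lemma a_le_double:
  assumes "j \<le> d + 2 * c + 1"
  shows "a j \<le> 2 * j"
proof (cases "j \<le> d + 1")
  case True
  then show ?thesis by (simp add: a_eq)
next
  case False
  define s where "s = j - (d + 1)"
  have s: "j = d + 1 + s" "s \<le> 2 * c"
    using False assms by (simp_all add: s_def)
  have "a j \<le> d + 1 + s * (2 * c + 1)"
    using a_le_after_linear s by simp
  also have "s * (2 * c + 1) \<le> 2 * c * (2 * c + 1)"
    using s(2) by (rule mult_right_mono) simp
  finally show ?thesis
    using d_bounds(2) s(1) by linarith
qed

section \<open>The ratio bound over a shift by \<open>d\<close>\<close>

lemma a_add_ge: "d + c < n \<Longrightarrow> a n + r * a (n - (d + c)) \<le> a (n + r)"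
proof (induction r)
  case (Suc r)
  have "a (n - (d + c)) \<le> a (n + r - (d + c))"
    by (rule a_mono) simp
  then show ?case
    using Suc a_Suc_ge[of "n + r"] by simp
qed simp

text \<open>Since \<open>a j \<le> 2 * j\<close>, a linear lower bound on \<open>a (j + d)\<close>
  suffices. For small \<open>j\<close> the summand \<open>d\<close> alone provides it; otherwise the
  last \<open>r\<close> steps before \<open>j + d\<close> each gain at least
  \<open>a (j - q) \<ge> j - q\<close>.\<close>

lemma ratio_init:
  assumes "j \<le> d + 2 * c + 1"
  shows "(6 * c + 4) * a j \<le> a (j + d)"
proof -
  \<comment> \<open>Going back \<open>r\<close> steps and then \<open>d + c\<close> from
    \<open>j + d\<close> lands at \<open>j - q\<close>. As \<open>j \<le> 2 * (j - q)\<close> for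
    large \<open>j\<close>, \<open>r = 4 * C\<close> gains reach \<open>2 * C * j\<close>.\<close>
  define C r q where "C = 6 * c + 4" and "r = 4 * C" and "q = r + c"
  have q: "q = 25 * c + 16"
    by (simp add: q_def r_def C_def)
  have "C * a j \<le> 2 * C * j"
    using a_le_double[OF assms] by simp
  also have "\<dots> \<le> a (j + d)"
  proof (cases "j \<le> 2 * q")
    case True
    then have "2 * C * j \<le> 4 * C * q"
      by simp
    also have "\<dots> \<le> j + d"
      using d_bounds(3) by (simp add: C_def q)
    finally show ?thesis
      using a_ge[of "j + d"] by simp
  next
    case False
    have "2 * C * j \<le> r * (j - q)"
    proof -
      have "2 * C * j \<le> 2 * C * (2 * (j - q))"
        using False by (intro mult_left_mono) simp_all
      then show ?thesis by (simp add: r_def)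
    qed
    also have "\<dots> \<le> r * a (j - q)"
      using a_ge by (intro mult_left_mono) simp_all
    also have "j - q = j + d - r - (d + c)"
      by (simp add: q_def)
    also have "r * a (j + d - r - (d + c)) \<le> a (j + d - r + r)"
    proof -
      have "d + c < j + d - r"
        using False by (simp add: q_def less_diff_conv)
      from a_add_ge[OF this, of r] show ?thesis by linarith
    qed
    finally show ?thesis
      using False q_def by simp
  qed
  finally show ?thesis by (simp add: C_def)
qed

text \<open>The left side needs the recurrence as an equality only below \<open>n\<close>; at the
  shifted index \<open>i + d\<close>, possibly beyond \<open>n\<close>, the inequality
  \<open>a_Suc_ge\<close> is enough.\<close>

lemma ratio_propagates:
  assumes rec: "\<And>i. d + 2 * c < i \<Longrightarrow> i < n \<Longrightarrow> a (Suc i) = a i + a (i - (d + c))"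
  shows "j \<le> n \<Longrightarrow> (6 * c + 4) * a j \<le> a (j + d)"
proof (induction j rule: less_induct)
  case (less j)
  show ?case
  proof (cases "j \<le> d + 2 * c + 1")
    case True
    then show ?thesis by (rule ratio_init)
  next
    case False
    then obtain i where i: "j = Suc i" "d + 2 * c < i"
      by (cases j) auto
    have "(6 * c + 4) * a j = (6 * c + 4) * a i + (6 * c + 4) * a (i - (d + c))"
      using rec[of i] i less.prems by (simp add: algebra_simps)
    also have "\<dots> \<le> a (i + d) + a (i - (d + c) + d)"
      using less.IH[of i] less.IH[of "i - (d + c)"] i less.prems by (intro add_mono) simp_all
    also have "i - (d + c) + d = i + d - (d + c)"
      using i by simp
    also have "a (i + d) + a (i + d - (d + c)) \<le> a (Suc (i + d))"
      using i by (intro a_Suc_ge) simp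
    finally show ?thesis using i by simp
  qed
qed

section \<open>Bounding \<open>M\<close> and deriving the recurrence\<close>

lemma M_le_double:
  assumes ratio: "\<And>j. j \<le> n \<Longrightarrow> (6 * c + 4) * a j \<le> a (j + d)"
  shows "i \<le> n \<Longrightarrow> M i \<le> 2 * a i"
proof (induction i rule: less_induct)
  case (less i)
  show ?case
  proof (cases "i \<le> d")
    case True
    then show ?thesis using M_le_a[of i] by simp
  next
    case False
    have "0 < d" using d_bounds(1) c_pos by simp
    then have "M (i - d) \<le> 2 * a (i - d)"
      using less False by (intro less.IH) simp_all
    also have "\<dots> \<le> (6 * c + 4) * a (i - d)"
      by (intro mult_right_mono) simp_all
    also have "\<dots> \<le> a i"
      using ratio[of "i - d"] False less.prems by simp
    finally show ?thesis using M_le[of i] by simp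
  qed
qed

text \<open>Each of the \<open>s\<close> increments is at most \<open>1 + M (i - d)\<close>, and
  \<open>a\<close> at the largest such argument bounds them all.\<close>

lemma a_add_le:
  assumes M2: "\<And>i. i \<le> n \<Longrightarrow> M i \<le> 2 * a i" and "m + s \<le> n"
  shows "a (m + s) \<le> a m + s * (1 + 2 * a (m + s - d))"
  using assms(2)
proof (induction s)
  case (Suc s)
  define x where "x = a (m + Suc s - d)"
  have "a (m + s - d) \<le> x"
    unfolding x_def by (rule a_mono) simp
  then have "s * (1 + 2 * a (m + s - d)) \<le> s * (1 + 2 * x)"
    by (intro mult_left_mono) simp_all
  then have "a (m + s) \<le> a m + s * (1 + 2 * x)"
    using Suc by linarith
  moreover have "m + s - d \<le> n"
    using Suc.prems by linarith
  then have "M (m + s - d) \<le> 2 * x"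
    using M2[of "m + s - d"] \<open>a (m + s - d) \<le> x\<close> by linarith
  ultimately show ?case
    using a_Suc_le[of "m + s"] unfolding x_def[symmetric] by simp
qed simp

text \<open>This is what remains of \<open>M (n - 1) < a n + a (n - k)\<close>, with
  \<open>m = n - 1 - k\<close>, after removing \<open>a (n - 1)\<close> from both sides. The
  \<open>c\<close> steps from \<open>m\<close> to \<open>m + c\<close> add only a small multiple of
  \<open>x\<close>, which is small compared with \<open>a m\<close>.\<close>

lemma M_bound:
  assumes ratio: "\<And>j. j \<le> n \<Longrightarrow> (6 * c + 4) * a j \<le> a (j + d)"
    and m: "c \<le> m" "m + c \<le> n"
  shows "M (m + c) < a m + a (Suc m)"
proof (cases "m + c \<le> d")
  case True
  then show ?thesis
    using M_le_a[of "m + c"] m by (simp add: a_eq)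
next
  case False
  have M2: "M i \<le> 2 * a i" if "i \<le> n" for i
    using ratio that by (rule M_le_double)
  define x where "x = a (m + c - d)"
  have up: "a (m + c) \<le> a m + c * (1 + 2 * x)"
    unfolding x_def using M2 m(2) by (rule a_add_le)
  have "(6 * c + 4) * x \<le> a (m + c)"
    using ratio[of "m + c - d"] False m by (simp add: x_def)
  \<comment> \<open>The growth from \<open>m\<close> to \<open>m + c\<close> absorbs
    \<open>2 * c * x\<close> of the \<open>(6 * c + 4) * x\<close>. The remaining factor
    \<open>4 * c + 4\<close> is twice the coefficient of \<open>x\<close> in the bound on
    \<open>M (m + c)\<close> below.\<close>
  then have x: "4 * x + 4 * (c * x) \<le> a m + c"
    using up by (simp add: algebra_simps)
  have "m + c - d \<le> n"
    using m(2) by linarith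
  then have "M (m + c - d) \<le> 2 * x"
    unfolding x_def by (rule M2)
  then have "M (m + c) \<le> a m + c + 2 * (c * x) + 2 * x"
    using M_le[of "m + c"] up by (simp add: algebra_simps)
  moreover have "3 * c \<le> a m"
    using a_ge[of m] False d_bounds(1) by simp
  ultimately show ?thesis
    using x a_less[of m] by linarith
qed

theorem recurrence:
  "d + 2 * c < n \<Longrightarrow> a (Suc n) = a n + a (n - (d + c))"
proof (induction n rule: less_induct)
  case (less n)
  define m where "m = n - 1 - (d + c)"
  have m: "n = Suc (m + (d + c))" "c \<le> m"
    using less.prems by (simp_all add: m_def)
  \<comment> \<open>The induction hypothesis is the recurrence below \<open>n\<close>, as
    \<open>ratio_propagates\<close> requires.\<close>
  have ratio: "(6 * c + 4) * a j \<le> a (j + d)" if "j \<le> n" for j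
    using that less.IH by (intro ratio_propagates[of n]) simp_all
  have "M (m + c) < a m + a (Suc m)"
    using m by (intro M_bound[of n] ratio) simp_all
  moreover have "M (n - 1) \<le> a (n - 1) + M (m + c)"
    using M_le[of "n - 1"] m by (simp add: algebra_simps)
  moreover have "a (n - 1) + a m \<le> a n"
    using a_Suc_ge[of "n - 1"] m c_pos by simp
  moreover have "n - (d + c) = Suc m"
    using m by simp
  ultimately show ?case
    using less.prems by (intro a_Suc_eq) simp_all
qed

end

section \<open>Legal sums\<close>

lemma legal_diff_notin:
  assumes "legal S L" "i \<in> L" "j \<in> L" "i < j"
  shows "j - i \<notin> S"
proof -
  have "nat \<bar>int j - int i\<bar> = j - i"
    using assms(4) by linarith
  then show ?thesis
    using assms(1-3) unfolding legal_def by metis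
qed

definition legal_sums :: "nat set \<Rightarrow> nat \<Rightarrow> nat set" where
  "legal_sums S n = (\<lambda>L. \<Sum>l\<in>L. lid S l) ` {L. L \<subseteq> {1..<n} \<and> legal S L}"

lemma finite_legal_sums: "finite (legal_sums S n)"
  unfolding legal_sums_def
  by (rule finite_imageI, rule finite_subset[of _ "Pow {1..<n}"]) auto

lemma zero_in_legal_sums: "0 \<in> legal_sums S n"
  unfolding legal_sums_def by (rule image_eqI[of _ _ "{}"]) (simp_all add: legal_def)

lemma legal_sums_mono: "m \<le> n \<Longrightarrow> legal_sums S m \<subseteq> legal_sums S n"
  unfolding legal_sums_def by (intro image_mono Collect_mono) fastforce

lemma lid_eq_Least: "lid S n = (LEAST m. 0 < m \<and> m \<notin> legal_sums S n)"
  by (subst lid.simps) (auto simp: legal_sums_def image_iff intro!: arg_cong[where f = Least])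

text \<open>There are finitely many legal sums, so the least excluded positive integer
  exists.\<close>

lemma lid_pos: "0 < lid S n"
  and lid_notin: "lid S n \<notin> legal_sums S n"
proof -
  obtain m where "m \<notin> insert 0 (legal_sums S n)"
    using ex_new_if_finite[of "insert 0 (legal_sums S n)"] finite_legal_sums by auto
  then have "0 < m \<and> m \<notin> legal_sums S n"
    by auto
  from LeastI[of "\<lambda>m. 0 < m \<and> m \<notin> legal_sums S n", OF this]
  show "0 < lid S n" "lid S n \<notin> legal_sums S n"
    by (simp_all flip: lid_eq_Least)
qed

lemma lid_le: "0 < m \<Longrightarrow> m \<notin> legal_sums S n \<Longrightarrow> lid S n \<le> m"
  unfolding lid_eq_Least by (rule Least_le) simp

lemma less_lid_in: "m < lid S n \<Longrightarrow> m \<in> legal_sums S n"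
  using lid_le[of m S n] zero_in_legal_sums[of S n] by (cases "m = 0") force+

lemma lid_in_legal_sums:
  assumes "0 \<notin> S" "1 \<le> n" "n < N"
  shows "lid S n \<in> legal_sums S N"
  unfolding legal_sums_def using assms
  by (intro image_eqI[of _ _ "{n}"]) (simp_all add: legal_def)

lemma lid_less_Suc:
  assumes "0 \<notin> S" "1 \<le> n"
  shows "lid S n < lid S (Suc n)"
proof -
  have "lid S (Suc n) \<notin> legal_sums S n"
    using lid_notin[of S "Suc n"] legal_sums_mono[of n "Suc n" S] by auto
  then have "lid S n \<le> lid S (Suc n)"
    by (intro lid_le lid_pos)
  moreover have "lid S n \<noteq> lid S (Suc n)"
    using lid_in_legal_sums[of S n "Suc n"] lid_notin[of S "Suc n"] assms by auto
  ultimately show ?thesis by simp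
qed

lemma lid_mono:
  assumes "0 \<notin> S" "1 \<le> m" "m < n"
  shows "lid S m < lid S n"
  using assms(3)
proof (induction n)
  case (Suc n)
  then show ?case
    using lid_less_Suc[of S n] assms by (cases "m = n") auto
qed simp

text \<open>Otherwise the excess over \<open>lid S n\<close> is below \<open>lid S (n - k)\<close>,
  hence a legal sum of indices below \<open>n - k\<close>. These are farther than \<open>k\<close>
  from \<open>n\<close>, so adjoining \<open>n\<close> stays legal and represents
  \<open>lid S (Suc n)\<close>.\<close>

lemma lid_Suc_ge:
  assumes S: "S \<subseteq> {1..k}" and n: "k < n"
  shows "lid S n + lid S (n - k) \<le> lid S (Suc n)"
proof (rule ccontr)
  assume less: "\<not> ?thesis"
  have "lid S (Suc n) \<notin> legal_sums S n"
    using lid_notin[of S "Suc n"] legal_sums_mono[of n "Suc n" S] by auto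
  then have "lid S n \<le> lid S (Suc n)"
    by (intro lid_le lid_pos)
  then obtain m where m: "lid S (Suc n) = lid S n + m"
    using le_Suc_ex by blast
  then have "m \<in> legal_sums S (n - k)"
    using less by (intro less_lid_in) simp
  then obtain L where L: "L \<subseteq> {1..<n - k}" "legal S L" "m = (\<Sum>l\<in>L. lid S l)"
    by (auto simp: legal_sums_def)
  have "nat \<bar>int n - int l\<bar> \<notin> S" "nat \<bar>int l - int n\<bar> \<notin> S" if "l \<in> L" for l
  proof -
    have "l < n - k" using L(1) that by auto
    then have "k < nat \<bar>int n - int l\<bar>" "k < nat \<bar>int l - int n\<bar>" by linarith+
    then show "nat \<bar>int n - int l\<bar> \<notin> S" "nat \<bar>int l - int n\<bar> \<notin> S"
      using S by auto
  qed
  moreover have "0 \<notin> S" using S by auto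
  ultimately have "legal S (insert n L)"
    using L(2) by (auto simp: legal_def)
  moreover have "insert n L \<subseteq> {1..<Suc n}"
    using L(1) n by (auto dest!: subsetD)
  moreover have "(\<Sum>l\<in>insert n L. lid S l) = lid S n + m"
  proof -
    have "finite L" "n \<notin> L"
      using L(1) finite_subset by (blast, force)
    then show ?thesis using L(3) by simp
  qed
  ultimately have "lid S n + m \<in> legal_sums S (Suc n)"
    unfolding legal_sums_def by (intro image_eqI[of _ _ "insert n L"]) simp_all
  then show False using lid_notin[of S "Suc n"] m by simp
qed

section \<open>The largest legal sum\<close>

definition max_legal_sum :: "nat set \<Rightarrow> nat \<Rightarrow> nat" where
  "max_legal_sum S n = Max (legal_sums S (Suc n))"

lemma le_max_legal_sum: "x \<in> legal_sums S (Suc n) \<Longrightarrow> x \<le> max_legal_sum S n"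
  unfolding max_legal_sum_def by (rule Max_ge[OF finite_legal_sums])

lemma max_legal_sum_in: "max_legal_sum S n \<in> legal_sums S (Suc n)"
  unfolding max_legal_sum_def using zero_in_legal_sums
  by (intro Max_in[OF finite_legal_sums]) auto

lemma max_legal_sum_0: "max_legal_sum S 0 = 0"
  using max_legal_sum_in[of S 0] by (auto simp: legal_sums_def)

lemma lid_Suc_le_max: "lid S (Suc n) \<le> max_legal_sum S n + 1"
  using le_max_legal_sum[of "max_legal_sum S n + 1" S n] by (intro lid_le) auto

text \<open>Remove the largest index \<open>p\<close> of an optimal set: the others are at least
  \<open>d\<close> below \<open>p\<close>, hence at most \<open>n - d\<close>.\<close>

lemma max_legal_sum_le:
  assumes gap: "{1..<d} \<subseteq> S" and S: "0 \<notin> S" and n: "1 \<le> n"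
  shows "max_legal_sum S n \<le> lid S n + max_legal_sum S (n - d)"
proof -
  obtain L where L: "L \<subseteq> {1..<Suc n}" "legal S L" "max_legal_sum S n = (\<Sum>l\<in>L. lid S l)"
    using max_legal_sum_in[of S n] by (auto simp: legal_sums_def)
  have fin: "finite L"
    using L(1) finite_subset by auto
  show ?thesis
  proof (cases "L = {}")
    case False
    define p where "p = Max L"
    have p: "p \<in> L" "p \<le> n" "1 \<le> p"
      using Max_in[OF fin False] L(1) by (auto simp: p_def)
    have "L - {p} \<subseteq> {1..<Suc (n - d)}"
    proof
      fix l assume l: "l \<in> L - {p}"
      then have "l < p"
        using Max_ge[OF fin, of l] by (auto simp: p_def)
      then have "p - l \<notin> {1..<d}"
        using legal_diff_notin[OF L(2), of l p] l p(1) gap by blast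
      then have "d \<le> p - l"
        using \<open>l < p\<close> by (simp add: Suc_le_eq not_less)
      then show "l \<in> {1..<Suc (n - d)}"
        using l L(1) p(2) \<open>l < p\<close> by auto
    qed
    moreover have "legal S (L - {p})"
      using L(2) by (auto simp: legal_def)
    ultimately have "(\<Sum>l\<in>L - {p}. lid S l) \<le> max_legal_sum S (n - d)"
      by (intro le_max_legal_sum) (auto simp: legal_sums_def)
    moreover have "lid S p \<le> lid S n"
      using lid_mono[OF S p(3), of n] p(2) by (cases "p = n") simp_all
    ultimately show ?thesis
      using L(3) sum.remove[OF fin p(1), of "lid S"] by simp
  qed (use L(3) in simp)
qed

text \<open>A legal set with this sum must contain \<open>n\<close>, by the bound on
  \<open>max_legal_sum\<close>. Its other terms sum to \<open>lid S (n - k)\<close>, so their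
  indices are at most \<open>n - k\<close>; the index \<open>n - k\<close> itself is at forbidden
  distance \<open>k\<close>. Then \<open>lid S (n - k)\<close> would be a sum of earlier
  terms.\<close>

lemma lid_Suc_eq:
  assumes S: "S \<subseteq> {1..k}" "k \<in> S" and n: "k < n"
    and less: "max_legal_sum S (n - 1) < lid S n + lid S (n - k)"
  shows "lid S (Suc n) = lid S n + lid S (n - k)"
proof (rule antisym[OF _ lid_Suc_ge[OF S(1) n]], rule lid_le)
  show "0 < lid S n + lid S (n - k)"
    by (simp add: lid_pos)
  have S0: "0 \<notin> S" using S(1) by auto
  show "lid S n + lid S (n - k) \<notin> legal_sums S (Suc n)"
  proof
    assume "lid S n + lid S (n - k) \<in> legal_sums S (Suc n)"
    then obtain L where L: "L \<subseteq> {1..<Suc n}" "legal S L"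
        "lid S n + lid S (n - k) = (\<Sum>l\<in>L. lid S l)"
      by (auto simp: legal_sums_def)
    have fin: "finite L"
      using L(1) finite_subset by auto
    show False
    proof (cases "n \<in> L")
      case False
      then have "L \<subseteq> {1..<Suc (n - 1)}"
        using L(1) n by (auto simp: less_Suc_eq)
      then have "(\<Sum>l\<in>L. lid S l) \<le> max_legal_sum S (n - 1)"
        using L(2) by (intro le_max_legal_sum) (auto simp: legal_sums_def)
      then show False using L(3) less by simp
    next
      case True
      then have eq: "lid S (n - k) = (\<Sum>l\<in>L - {n}. lid S l)"
        using L(3) sum.remove[OF fin True, of "lid S"] by simp
      have "L - {n} \<subseteq> {1..<n - k}"
      proof
        fix l assume l: "l \<in> L - {n}"
        have "lid S l \<le> lid S (n - k)"
          unfolding eq using l fin by (intro member_le_sum) auto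
        then have "l \<le> n - k"
          using lid_mono[OF S0, of "n - k" l] n by (cases "n - k < l") (simp_all add: Suc_le_eq)
        moreover have "l \<noteq> n - k"
        proof
          assume "l = n - k"
          moreover from this have "l < n"
            using l L(1) by force
          ultimately show False
            using legal_diff_notin[OF L(2), of l n] True l S(2) n by simp
        qed
        ultimately show "l \<in> {1..<n - k}"
          using l L(1) by auto
      qed
      moreover have "legal S (L - {n})"
        using L(2) by (auto simp: legal_def)
      ultimately have "lid S (n - k) \<in> legal_sums S (n - k)"
        unfolding eq by (auto simp: legal_sums_def)
      then show False using lid_notin by blast
    qed
  qed
qed

(* On nat, k - t truncates to 0 when t > k; as 0 is not in {1..k}, the set difference
   still agrees with the integer reading for every k. *)
theorem theorem1p12:
  fixes T :: "nat set" and c :: nat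
  assumes "finite T" and "T \<noteq> {}" and "\<forall>t\<in>T. 0 < t" and "c = Max T"
  shows "\<exists>K::nat. \<forall>k\<ge>K.
    (let S = {1..k} - (\<lambda>t. k - t) ` T
     in \<forall>n>k + c. lid S (n + 1) = lid S n + lid S (n - k))"
proof -
  have c: "0 < c" "\<And>t. t \<in> T \<Longrightarrow> t \<le> c"
    using assms by simp_all
  have "lid S (n + 1) = lid S n + lid S (n - k)"
    if k: "16 * (6 * c + 4) * (25 * c + 16) + c \<le> k"
      and S_def: "S = {1..k} - (\<lambda>t. k - t) ` T" and n: "k + c < n" for k n S
  proof -
    define d where "d = k - c"
    have d: "k = d + c" "16 * (6 * c + 4) * (25 * c + 16) \<le> d"
      using k by (simp_all add: d_def)
    have S: "S \<subseteq> {1..k}" "0 \<notin> S"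
      by (auto simp: S_def)
    \<comment> \<open>Every \<open>t\<close> is positive, so \<open>k - t\<close> never equals
      \<open>k\<close>.\<close>
    have "k \<in> S"
      using assms(3) c(1) d(1) by (force simp: S_def)
    \<comment> \<open>Every removed difference is at least \<open>k - c = d\<close>.\<close>
    have gap: "{1..<d} \<subseteq> S"
      using c(2) d(1) by (fastforce simp: S_def)
    \<comment> \<open>\<open>lid S 0\<close> equals \<open>lid S 1\<close>; resetting index 0 to 0
      makes the sequence strictly increasing from the start.\<close>
    define a where "a i = (if i = 0 then 0 else lid S i)" for i
    interpret gap_growth a "max_legal_sum S" c d
    proof
      show "a i < a (Suc i)" for i
        using lid_pos lid_less_Suc[OF S(2), of i] by (simp add: a_def)
      show "max_legal_sum S i \<le> a i + max_legal_sum S (i - d)" for i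
        using max_legal_sum_le[OF gap S(2), of i] by (cases "i = 0") (simp_all add: a_def)
      show "a i + a (i - (d + c)) \<le> a (Suc i)" if "d + c < i" for i
        using lid_Suc_ge[OF S(1), of i] that d(1) by (simp add: a_def)
      show "a (Suc i) = a i + a (i - (d + c))"
        if "d + c < i" "max_legal_sum S (i - 1) < a i + a (i - (d + c))" for i
        using lid_Suc_eq[OF S(1) \<open>k \<in> S\<close>, of i] that d(1) by (simp add: a_def)
    qed (use c(1) d(2) lid_Suc_le_max in \<open>simp_all add: a_def max_legal_sum_0\<close>)
    show ?thesis
      using recurrence[of n] n d(1) by (simp add: a_def)
  qed
  then show ?thesis
    unfolding Let_def by blast
qed

end
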